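(* Let $m,\ell$ be coprime integers with $\ell>m$ and $\ell\neq-m$, let $c_1,c_2$ be nonzero real numbers, and let $f(t)=c_1e^{itm}+c_2e^{it\ell}$, $t\in\mathbb{R}$. Suppose that $mc_1=-\ell c_2$. Then the set of the local singular points of the curve $f$ coincides with the set of points $w_k=f(\tau_k)$, where $$\tau_k=\frac{2k}{\ell-m}\pi \pmod{2\pi},\qquad 0\le k\le \ell-m-1 .$$
   Context: Write $f=\phi+i\psi$ with $\phi,\psi$ real-valued. The local singular points of the curve $x=\phi(t)$, $y=\psi(t)$ are those points where $\dot\phi(t)=\dot\psi(t)=0$. *)

theory Defs
  imports "HOL-Analysis.Analysis" "HOL-Library.Real_Mod"
begin

text \<open>The local singular points of the curve \<open>x = Re (f t)\<close>, \<open>y = Im (f t)\<close>, as points of the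
  plane rather than parameter values. We use \<open>has_real_derivative\<close> instead of \<open>deriv\<close>, whose value
  is unspecified where \<open>f\<close> is not differentiable.\<close>

definition local_singular_points :: "(real \<Rightarrow> complex) \<Rightarrow> complex set" where
  "local_singular_points f =
     {f t | t. ((\<lambda>s. Re (f s)) has_real_derivative 0) (at t) \<and>
               ((\<lambda>s. Im (f s)) has_real_derivative 0) (at t)}"

end

theory Submission
  imports Defs
begin

text \<open>
  The velocity of the curve is \<open>i m c1 (e^{itm} - e^{itl})\<close>, because the relation
  \<open>m c1 = - l c2\<close> makes its two Fourier coefficients opposite. The factor \<open>m c1\<close> is nonzero:
  \<open>m = 0\<close> would force \<open>l c2 = 0\<close>, hence \<open>l = 0 = m\<close>,
  against \<open>l > m\<close>. So the velocity vanishes exactly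
  when \<open>e^{it(l-m)} = 1\<close>, that is, when \<open>t = 2 \<pi> n / (l - m)\<close> for some integer \<open>n\<close>. The curve has
  period \<open>2 \<pi>\<close>, so only the residue of \<open>n\<close> modulo \<open>l - m\<close> matters for the point \<open>f t\<close>, and
  likewise only the class of a parameter modulo \<open>2 \<pi>\<close>.
\<close>

text \<open>
  The coordinates of the velocity are the derivatives of the coordinates, and a derivative is
  unique, so a coordinate of a differentiable curve has derivative \<open>0\<close> only where that
  coordinate of the velocity is \<open>0\<close>.
\<close>

lemma local_singular_points_eq_zeros_of_velocity:
  assumes "\<And>t. (f has_vector_derivative f' t) (at t)"
  shows "local_singular_points f = f ` {t. f' t = 0}"
proof -
  have "((\<lambda>s. Re (f s)) has_real_derivative 0) (at t) \<and>
        ((\<lambda>s. Im (f s)) has_real_derivative 0) (at t) \<longleftrightarrow> f' t = 0" for t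
  proof -
    have Re: "((\<lambda>s. Re (f s)) has_real_derivative Re (f' t)) (at t)"
      and Im: "((\<lambda>s. Im (f s)) has_real_derivative Im (f' t)) (at t)"
      using assms[of t] by (simp_all add: has_vector_derivative_complex_iff)
    have "((\<lambda>s. Re (f s)) has_real_derivative 0) (at t) \<longleftrightarrow> Re (f' t) = 0"
      using Re DERIV_unique[OF Re] by metis
    moreover have "((\<lambda>s. Im (f s)) has_real_derivative 0) (at t) \<longleftrightarrow> Im (f' t) = 0"
      using Im DERIV_unique[OF Im] by metis
    ultimately show ?thesis
      by (simp add: complex_eq_iff)
  qed
  then show ?thesis
    by (auto simp: local_singular_points_def)
qed

lemma two_frequency_curve_periodic:
  fixes a b :: complex and m l :: int
  defines "f \<equiv> \<lambda>t::real. a * exp (\<i> * of_real t * of_int m) + b * exp (\<i> * of_real t * of_int l)"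
  assumes "[s = t] (rmod (2 * pi))"
  shows "f s = f t"
proof -
  from assms(2) obtain n where n: "t = s + of_int n * (2 * pi)"
    by (auto simp: rcong_altdef)
  have "exp (\<i> * of_real t * of_int k) = exp (\<i> * of_real s * of_int k)" for k :: int
    unfolding exp_eq by (intro exI[of _ "n * k"]) (simp add: n algebra_simps)
  then show ?thesis
    by (simp add: f_def)
qed

lemma two_frequency_velocity:
  fixes a b :: complex and m l :: int and t :: real
  shows "((\<lambda>t. a * exp (\<i> * of_real t * of_int m) + b * exp (\<i> * of_real t * of_int l))
           has_vector_derivative
           \<i> * (of_int m * a * exp (\<i> * of_real t * of_int m)
                + of_int l * b * exp (\<i> * of_real t * of_int l))) (at t)"
proof -
  \<comment> \<open>The curve is the restriction to the real line of an entire function, which is differentiated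
    by the complex chain rule.\<close>
  have "((\<lambda>z. a * exp (\<i> * z * of_int m) + b * exp (\<i> * z * of_int l))
           has_field_derivative
           \<i> * (of_int m * a * exp (\<i> * of_real t * of_int m)
                + of_int l * b * exp (\<i> * of_real t * of_int l))) (at (of_real t))"
    by (auto intro!: derivative_eq_intros simp: algebra_simps)
  then show ?thesis
    by (rule has_vector_derivative_real_field)
qed

theorem theorem7p4:
  fixes m l :: int and c1 c2 :: real and f :: "real \<Rightarrow> complex" and \<tau> :: "int \<Rightarrow> real"
  assumes "coprime m l" and "l > m" and "l \<noteq> - m"
    and "c1 \<noteq> 0" and "c2 \<noteq> 0"
    and "f = (\<lambda>t. complex_of_real c1 * exp (\<i> * complex_of_real t * of_int m)
                 + complex_of_real c2 * exp (\<i> * complex_of_real t * of_int l))"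
    and "of_int m * c1 = - of_int l * c2"
    and "\<And>k. 0 \<le> k \<Longrightarrow> k \<le> l - m - 1 \<Longrightarrow>
           [\<tau> k = 2 * of_int k / of_int (l - m) * pi] (rmod (2 * pi))"
  shows "local_singular_points f = {f (\<tau> k) | k. 0 \<le> k \<and> k \<le> l - m - 1}"
proof -
  define d where "d = l - m"
  have d: "d > 0"
    using assms(2) by (simp add: d_def)
  define \<sigma> where "\<sigma> n = 2 * of_int n / of_int d * pi" for n :: int
  have m: "m \<noteq> 0"
    using assms(2,5,7) by auto
  have c2: "of_int l * complex_of_real c2 = - (of_int m * complex_of_real c1)"
    using arg_cong[OF assms(7), of complex_of_real] by simp

  have velocity_zero: "\<i> * (of_int m * complex_of_real c1 * exp (\<i> * of_real t * of_int m)
      + of_int l * complex_of_real c2 * exp (\<i> * of_real t * of_int l)) = 0 \<longleftrightarrow> t \<in> range \<sigma>"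
    for t
  proof -
    have "\<i> * (of_int m * complex_of_real c1 * exp (\<i> * of_real t * of_int m)
        + of_int l * complex_of_real c2 * exp (\<i> * of_real t * of_int l)) = 0
      \<longleftrightarrow> exp (\<i> * of_real t * of_int l) = exp (\<i> * of_real t * of_int m)"
      using m assms(4) by (auto simp: c2)
    also have "\<dots> \<longleftrightarrow> (\<exists>n::int. t * of_int l = t * of_int m + of_int (2 * n) * pi)"
      unfolding exp_eq by (simp add: complex_eq_iff)
    also have "\<dots> \<longleftrightarrow> (\<exists>n. t = \<sigma> n)"
      using d by (simp add: \<sigma>_def d_def field_simps)
    finally show ?thesis
      by auto
  qed
  have singular: "local_singular_points f = f ` range \<sigma>"
    unfolding assms(6)
    by (subst local_singular_points_eq_zeros_of_velocity[OF two_frequency_velocity])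
       (simp only: velocity_zero Collect_mem_eq)

  have periodic: "f s = f t" if "[s = t] (rmod (2 * pi))" for s t
    unfolding assms(6) by (rule two_frequency_curve_periodic[OF that])
  have reduce: "f (\<sigma> n) = f (\<sigma> (n mod d))" for n
  proof -
    have "real_of_int n = of_int (n div d) * of_int d + of_int (n mod d)"
      by (metis of_int_add of_int_mult div_mult_mod_eq)
    then have "\<sigma> n = \<sigma> (n mod d) + of_int (n div d) * (2 * pi)"
      using d by (simp add: \<sigma>_def field_simps)
    then have "[\<sigma> (n mod d) = \<sigma> n] (rmod (2 * pi))"
      by (auto simp: rcong_altdef)
    then show ?thesis
      by (simp add: periodic)
  qed
  have "f ` range \<sigma> = {f (\<sigma> k) | k. 0 \<le> k \<and> k \<le> d - 1}"
  proof (intro equalityI subsetI)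
    fix w assume "w \<in> f ` range \<sigma>"
    then obtain n where "w = f (\<sigma> (n mod d))"
      using reduce by auto
    moreover have "0 \<le> n mod d" "n mod d \<le> d - 1"
      using d by simp_all
    ultimately show "w \<in> {f (\<sigma> k) | k. 0 \<le> k \<and> k \<le> d - 1}"
      by blast
  qed blast
  also have "\<dots> = {f (\<tau> k) | k. 0 \<le> k \<and> k \<le> d - 1}"
  proof -
    have "f (\<tau> k) = f (\<sigma> k)" if "0 \<le> k" "k \<le> d - 1" for k
      using assms(8)[of k] that by (intro periodic) (simp add: \<sigma>_def d_def)
    then show ?thesis
      by (intro Collect_cong ex_cong1) auto
  qed
  finally show ?thesis
    unfolding singular d_def .
qed

end
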